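(* Assume the Continuum Hypothesis. Then for every $n \in \mathbb{N}\setminus\{0\}$ and every $m \in \mathbb{N}$ there exists a maximal cofinitary group $G \le \mathrm{Sym}(\mathbb{N})$ whose natural action on $\mathbb{N}$ has exactly $n$ infinite orbits and exactly $m$ finite orbits.
   Context: $\mathrm{Sym}(\mathbb{N})$ is the group of bijections $\mathbb{N}\to\mathbb{N}$ under composition. A permutation is cofinitary if it is the identity or has only finitely many fixed points. A subgroup of $\mathrm{Sym}(\mathbb{N})$ is cofinitary if all its elements are cofinitary, and maximal cofinitary if it is cofinitary and not properly contained in another cofinitary subgroup. The natural action is $g\cdot k = g(k)$. *)

theory Defs
  imports Main "HOL-Library.Equipollence"
begin

definition CH :: bool where
  "CH \<longleftrightarrow> (\<forall>A :: nat set set. countable A \<or> A \<approx> (UNIV :: nat set set))"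

definition Sym_nat :: "(nat \<Rightarrow> nat) set" where
  "Sym_nat = {f. bij f}"

definition perm_subgroup :: "(nat \<Rightarrow> nat) set \<Rightarrow> bool" where
  "perm_subgroup G \<longleftrightarrow> G \<subseteq> Sym_nat \<and> id \<in> G
     \<and> (\<forall>f\<in>G. \<forall>g\<in>G. f \<circ> g \<in> G) \<and> (\<forall>f\<in>G. inv f \<in> G)"

definition cofinitary_perm :: "(nat \<Rightarrow> nat) \<Rightarrow> bool" where
  "cofinitary_perm g \<longleftrightarrow> g = id \<or> finite {k. g k = k}"

definition cofinitary_group :: "(nat \<Rightarrow> nat) set \<Rightarrow> bool" where
  "cofinitary_group G \<longleftrightarrow> perm_subgroup G \<and> (\<forall>g\<in>G. cofinitary_perm g)"

definition maximal_cofinitary_group :: "(nat \<Rightarrow> nat) set \<Rightarrow> bool" where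
  "maximal_cofinitary_group G \<longleftrightarrow> cofinitary_group G
     \<and> (\<forall>H. cofinitary_group H \<and> G \<subseteq> H \<longrightarrow> H = G)"

definition orbit :: "(nat \<Rightarrow> nat) set \<Rightarrow> nat \<Rightarrow> nat set" where
  "orbit G k = {g k | g. g \<in> G}"

definition orbits :: "(nat \<Rightarrow> nat) set \<Rightarrow> nat set set" where
  "orbits G = {orbit G k | k. True}"

end

theory Submission
  imports Defs "HOL-Library.Countable_Set"
begin

text \<open>
  Colour \<open>\<nat>\<close> so that \<open>m\<close> classes are singletons and \<open>n\<close> classes are infinite, and work only with
  colour-preserving permutations. Start from a copy of the integers acting freely and transitively on
  each infinite class and trivially below \<open>m\<close>; the orbits of every larger colour-preserving group
  are then exactly the classes.

  By CH the permutations \<open>h\<close> can be listed so that every one has only countably many predecessors.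
  If \<open>h\<close> is not in the current countable group \<open>G\<close> but still generates a cofinitary group with it,
  add a colour-preserving \<open>g\<close>, free over \<open>G\<close>, that commutes with \<open>h\<close> at infinitely many points but
  not everywhere. The commutator of \<open>g\<close> and \<open>h\<close> then excludes \<open>h\<close> from every larger cofinitary
  group. Asking for commutation rather than for agreement of \<open>g\<close> with \<open>h\<close> is what allows \<open>h\<close> to mix
  the colours.

  The permutation \<open>g\<close> is a union of finite partial injections. A fixed point of a cyclically reduced
  word in \<open>G\<close> and \<open>g\<close> is a closed path, and each new pair is attached at a point so generic that
  no closed path with coefficients among the first finitely many elements of \<open>G\<close> can use it. So each
  word acquires fixed points only at finitely many stages.
\<close>

section \<open>Closed paths in partial permutations\<close>

text \<open>The letter \<open>(a, e)\<close> stands for: first \<open>a\<close>, then the new permutation (if \<open>e\<close>) or its inverse.\<close>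

type_synonym letter = "(nat \<Rightarrow> nat) \<times> bool"

definition edge :: "(nat \<times> nat) set \<Rightarrow> letter \<Rightarrow> nat \<Rightarrow> nat \<Rightarrow> bool" where
  "edge p l x y \<longleftrightarrow> (if snd l then (fst l x, y) \<in> p else (y, fst l x) \<in> p)"

text \<open>Indexing by all naturals with period \<open>r\<close> handles the wrap-around of a
  cyclic word without modular arithmetic.\<close>

definition closed_path :: "(nat \<times> nat) set \<Rightarrow> nat \<Rightarrow> (nat \<Rightarrow> letter) \<Rightarrow> (nat \<Rightarrow> nat) \<Rightarrow> bool" where
  "closed_path p r w x \<longleftrightarrow> (\<forall>i. w (i + r) = w i \<and> x (i + r) = x i \<and> edge p (w i) (x i) (x (Suc i)))"

text \<open>On a periodic word this is cyclic reducedness: the new permutation never meets its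
  inverse with only the identity in between.\<close>

definition reduced :: "(nat \<Rightarrow> letter) \<Rightarrow> bool" where
  "reduced w \<longleftrightarrow> (\<forall>i. snd (w i) = snd (w (Suc i)) \<or> fst (w (Suc i)) \<noteq> id)"

text \<open>For a partial injection \<open>p\<close>, such a \<open>v\<close> meets at most one
  pair, and no nonidentity coefficient from \<open>F\<close> offers another way into or out of
  it.\<close>

definition pendant :: "(nat \<Rightarrow> nat) set \<Rightarrow> (nat \<times> nat) set \<Rightarrow> nat \<Rightarrow> bool" where
  "pendant F p v \<longleftrightarrow> \<not> (v \<in> Domain p \<and> v \<in> Range p)
     \<and> (\<forall>a\<in>F. a \<noteq> id \<longrightarrow> a v \<notin> Field p \<and> v \<notin> a ` Field p)"

text \<open>Closed paths stand for fixed points of words, so a safe extension creates no new fixed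
  points for cyclically reduced words over \<open>F\<close>.\<close>

definition safe :: "(nat \<Rightarrow> nat) set \<Rightarrow> (nat \<times> nat) set \<Rightarrow> (nat \<times> nat) set \<Rightarrow> bool" where
  "safe F p p' \<longleftrightarrow> (\<forall>r w x. 0 < r \<longrightarrow> closed_path p' r w x \<longrightarrow> reduced w
     \<longrightarrow> (\<forall>i. fst (w i) \<in> F) \<longrightarrow> closed_path p r w x)"

lemma safe_refl: "safe F p p"
  by (simp add: safe_def)

lemma safe_trans: "safe F p q \<Longrightarrow> safe F q s \<Longrightarrow> safe F p s"
  by (simp add: safe_def)

lemma edge_Field: "edge p l x y \<Longrightarrow> fst l x \<in> Field p \<and> y \<in> Field p"
  by (auto simp: edge_def Field_def split: if_splits)

text \<open>A closed path entering a pendant vertex would have to leave it through the same edge.\<close>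

lemma closed_path_avoids_pendant:
  assumes v: "pendant F p v" and cp: "closed_path p r w x" and "0 < r"
    and red: "reduced w" and F: "\<And>i. fst (w i) \<in> F"
  shows "fst (w i) (x i) \<noteq> v \<and> x (Suc i) \<noteq> v"
proof -
  have E: "edge p (w j) (x j) (x (Suc j))" for j
    using cp by (simp add: closed_path_def)
  have enter: "x (Suc j) \<noteq> v" for j
  proof
    assume x: "x (Suc j) = v"
    have "fst (w (Suc j)) v \<in> Field p"
      using edge_Field[OF E, of "Suc j"] x by simp
    with v F have 1: "fst (w (Suc j)) = id"
      by (auto simp: pendant_def)
    with red have "snd (w j) = snd (w (Suc j))"
      by (auto simp: reduced_def)
    with E[of j] E[of "Suc j"] x 1 v show False
      by (auto simp: edge_def pendant_def split: if_splits)
  qed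
  have leave: "fst (w (Suc j)) (x (Suc j)) \<noteq> v" for j
  proof
    assume y: "fst (w (Suc j)) (x (Suc j)) = v"
    have "x (Suc j) \<in> Field p"
      using edge_Field[OF E] by blast
    with y v F have "fst (w (Suc j)) = id"
      by (auto simp: pendant_def)
    with y enter show False by simp
  qed
  \<comment> \<open>\<open>leave\<close> covers only positions that have a predecessor; position
    \<open>0\<close> is reached as position \<open>r\<close>.\<close>
  have "fst (w (i + r)) (x (i + r)) \<noteq> v"
    using leave[of "i + r - 1"] \<open>0 < r\<close> by simp
  with cp enter show ?thesis
    by (simp add: closed_path_def)
qed

text \<open>A path traverses a pair by passing through both of its ends. It never visits a pendant
  point, so it never uses a pair of \<open>q\<close>.\<close>

lemma safe_pendant:
  assumes "\<And>u v. (u, v) \<in> q \<Longrightarrow> pendant F (p \<union> q) u \<or> pendant F (p \<union> q) v"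
  shows "safe F p (p \<union> q)"
  unfolding safe_def
proof (intro allI impI)
  fix r w x
  assume *: "0 < r" "closed_path (p \<union> q) r w x" "reduced w" "\<forall>i. fst (w i) \<in> F"
  note av = closed_path_avoids_pendant[OF _ *(2,1,3)]
  have "edge p (w i) (x i) (x (Suc i))" for i
  proof -
    have "edge (p \<union> q) (w i) (x i) (x (Suc i))"
      using *(2) by (simp add: closed_path_def)
    with av[of F _ i] *(4) assms show ?thesis
      by (fastforce simp: edge_def split: if_splits)
  qed
  with * show "closed_path p r w x"
    by (simp add: closed_path_def)
qed

section \<open>Words over a group and one new permutation\<close>

text \<open>The leftmost letter acts first, so a word is read along its path. A coefficient after
  the last letter has to be supplied separately.\<close>

fun word_eval :: "(nat \<Rightarrow> nat) \<Rightarrow> letter list \<Rightarrow> nat \<Rightarrow> nat" where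
  "word_eval g [] = id"
| "word_eval g ((a, e) # w) = word_eval g w \<circ> (if e then g else inv g) \<circ> a"

definition cyclically_reduced :: "letter list \<Rightarrow> bool" where
  "cyclically_reduced w \<longleftrightarrow> reduced (\<lambda>i. w ! (i mod length w))"

lemma word_eval_append: "word_eval g (u @ v) = word_eval g v \<circ> word_eval g u"
proof (induction u)
  case (Cons l u)
  then show ?case by (cases l) (simp add: comp_assoc)
qed simp

text \<open>\<open>d \<circ> f\<close> is a conjugate of \<open>f \<circ> d\<close>: the injection
  \<open>f\<close> maps its fixed points to fixed points of \<open>f \<circ> d\<close>.\<close>

lemma cofinitary_perm_comp_commute:
  assumes "bij f" "bij d" "cofinitary_perm (f \<circ> d)"
  shows "cofinitary_perm (d \<circ> f)"
proof (cases "f \<circ> d = id")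
  case True
  then have "f (d (f k)) = f k" for k
    by (metis comp_apply id_apply)
  then have "d \<circ> f = id"
    using bij_is_inj[OF \<open>bij f\<close>] by (auto simp: fun_eq_iff inj_eq)
  then show ?thesis by (simp add: cofinitary_perm_def)
next
  case False
  then have "finite {k. (f \<circ> d) k = k}"
    using assms(3) by (simp add: cofinitary_perm_def)
  then have "finite (f -` {k. (f \<circ> d) k = k})"
    by (rule finite_vimageI[OF _ bij_is_inj[OF \<open>bij f\<close>]])
  moreover have "{k. (d \<circ> f) k = k} \<subseteq> f -` {k. (f \<circ> d) k = k}"
    by auto
  ultimately show ?thesis
    by (auto simp: cofinitary_perm_def intro: finite_subset)
qed

lemma word_eval_bij:
  assumes "bij g" "\<And>a e. (a, e) \<in> set w \<Longrightarrow> bij a"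
  shows "bij (word_eval g w)"
  using assms by (induction g w rule: word_eval.induct) (auto intro!: bij_comp bij_imp_bij_inv)

text \<open>Strong induction on the length. A word that is not cyclically reduced is rotated, which
  is a conjugation, until the cancelling letters come first. Deleting them leaves the coefficient of
  the first one behind, and the factor \<open>a\<close> accommodates it.\<close>

lemma cofinitary_word_eval:
  assumes G: "cofinitary_group G" and "bij g"
    and red: "\<And>w. w \<noteq> [] \<Longrightarrow> w \<in> lists (G \<times> UNIV) \<Longrightarrow> cyclically_reduced w
                \<Longrightarrow> finite {k. word_eval g w k = k}"
  shows "w \<in> lists (G \<times> UNIV) \<Longrightarrow> a \<in> G \<Longrightarrow> cofinitary_perm (word_eval g w \<circ> a)"
proof (induction "length w" arbitrary: w a rule: less_induct)
  case less
  have bijG: "bij f" if "f \<in> G" for f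
    using G that by (auto simp: cofinitary_group_def perm_subgroup_def Sym_nat_def)
  have mult: "f \<circ> f' \<in> G" if "f \<in> G" "f' \<in> G" for f f'
    using G that by (auto simp: cofinitary_group_def perm_subgroup_def)
  have bijW: "bij (word_eval g u)" if "u \<in> lists (G \<times> UNIV)" for u
    using that bijG by (intro word_eval_bij[OF \<open>bij g\<close>]) auto
  show ?case
  proof (cases w)
    case Nil
    then show ?thesis
      using G less.prems by (auto simp: cofinitary_group_def)
  next
    case (Cons l u)
    obtain b e where l: "l = (b, e)" by force
    define w' where "w' = (b \<circ> a, e) # u"
    have ev: "word_eval g w \<circ> a = word_eval g w'"
      by (simp add: Cons l w'_def comp_assoc)
    have w': "w' \<in> lists (G \<times> UNIV)" "w' \<noteq> []" and len: "length w' = length w"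
      using less.prems mult by (auto simp: w'_def Cons l)
    show ?thesis
    proof (cases "cyclically_reduced w'")
      case True
      with red w' ev show ?thesis by (simp add: cofinitary_perm_def)
    next
      case False
      then obtain i where i: "snd (w' ! (i mod length w')) \<noteq> snd (w' ! (Suc i mod length w'))"
         "fst (w' ! (Suc i mod length w')) = id"
        by (auto simp: cyclically_reduced_def reduced_def)
      define v where "v = rotate i w'"
      have lv: "length v = length w" by (simp add: v_def len)
      have v: "v \<in> lists (G \<times> UNIV)"
        using w' by (auto simp: v_def)
      \<comment> \<open>In a one-letter word both cyclic neighbours are the same letter, so their
        signs cannot differ.\<close>
      have "length w \<noteq> 1"
        using i by (auto simp: len)
      with Cons have l2: "length v \<ge> 2"
        by (cases u) (auto simp: lv)
      then have v0: "v ! 0 = w' ! (i mod length w')" and v1: "v ! 1 = w' ! (Suc i mod length w')"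
        using nth_rotate[of 0 w' i] nth_rotate[of 1 w' i] w'(2) by (auto simp: v_def)
      obtain l0 l1 t where vt: "v = l0 # l1 # t"
        using l2 by (auto simp: numeral_2_eq_2 Suc_le_length_iff)
      obtain d s where l0: "l0 = (d, s)" by force
      have l1: "l1 = (id, \<not> s)"
        using i v0 v1 by (simp add: vt l0 prod_eq_iff)
      have "word_eval g v = word_eval g t \<circ> d"
        using \<open>bij g\<close> by (auto simp: vt l0 l1 fun_eq_iff bij_is_inj bij_is_surj surj_f_inv_f)
      moreover have "cofinitary_perm (word_eval g t \<circ> d)"
        using v by (intro less.hyps) (auto simp: lv[symmetric] vt l0)
      ultimately have cv: "cofinitary_perm (word_eval g v)" by simp
      let ?k = "i mod length w'"
      have parts: "drop ?k w' \<in> lists (G \<times> UNIV)" "take ?k w' \<in> lists (G \<times> UNIV)"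
        using w'(1) by (auto dest: in_set_dropD in_set_takeD)
      have "word_eval g v = word_eval g (take ?k w') \<circ> word_eval g (drop ?k w')"
        by (simp add: v_def rotate_drop_take word_eval_append)
      then have "cofinitary_perm (word_eval g (drop ?k w') \<circ> word_eval g (take ?k w'))"
        using cofinitary_perm_comp_commute[OF bijW[OF parts(2)] bijW[OF parts(1)]] cv by simp
      then show ?thesis
        by (simp add: ev word_eval_append[symmetric])
    qed
  qed
qed

section \<open>The subgroup generated by a group and one new permutation\<close>

inductive_set generated :: "(nat \<Rightarrow> nat) set \<Rightarrow> (nat \<Rightarrow> nat) set" for S where
  generated_id: "id \<in> generated S"
| generated_comp: "f \<in> generated S \<Longrightarrow> s \<in> S \<Longrightarrow> s \<circ> f \<in> generated S"

lemma generated_mult: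
  "f \<in> generated S \<Longrightarrow> f' \<in> generated S \<Longrightarrow> f \<circ> f' \<in> generated S"
  by (induction rule: generated.induct) (auto simp: comp_assoc intro: generated.intros)

lemma generated_incl: "s \<in> S \<Longrightarrow> s \<in> generated S"
  using generated_comp[OF generated_id] by fastforce

text \<open>\<open>generated\<close> only multiplies generators, so inverses come from
  \<open>S\<close> being closed under \<open>inv\<close>. For this reason \<open>g\<close> is always
  adjoined together with \<open>inv g\<close>.\<close>

lemma generated_perm_subgroup:
  assumes "S \<subseteq> Sym_nat" "\<And>s. s \<in> S \<Longrightarrow> inv s \<in> S"
  shows "perm_subgroup (generated S)"
proof -
  have "bij f \<and> inv f \<in> generated S" if "f \<in> generated S" for f
    using that
  proof induction
    case generated_id
    show ?case
      using generated.generated_id bij_id by (metis inv_id)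
  next
    case (generated_comp f s)
    then have "bij s" using assms by (auto simp: Sym_nat_def)
    moreover from this have "inv (s \<circ> f) = inv f \<circ> inv s"
      using generated_comp by (intro o_inv_distrib) auto
    moreover have "inv s \<in> generated S"
      using generated_comp assms by (intro generated_incl) auto
    ultimately show ?case
      using generated_comp.IH bij_comp[of f s] generated_mult by metis
  qed
  then show ?thesis
    by (auto simp: perm_subgroup_def Sym_nat_def generated_id generated_mult)
qed

text \<open>Multiplying by an element of \<open>G\<close> changes only the outer coefficient
  \<open>b\<close>; multiplying by \<open>g\<close> or \<open>inv g\<close> turns \<open>b\<close>
  into the coefficient of a new last letter.\<close>

lemma generated_word:
  assumes G: "perm_subgroup G" and f: "f \<in> generated (G \<union> {g, inv g})"
  shows "\<exists>b\<in>G. \<exists>w\<in>lists (G \<times> UNIV). f = b \<circ> word_eval g w"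
  using f
proof induction
  case generated_id
  have "id = id \<circ> word_eval g []" by simp
  with G show ?case
    unfolding perm_subgroup_def by blast
next
  case (generated_comp f s)
  then obtain b w where bw: "b \<in> G" "w \<in> lists (G \<times> UNIV)" "f = b \<circ> word_eval g w"
    by blast
  show ?case
  proof (cases "s \<in> G")
    case True
    then have "s \<circ> b \<in> G" using bw G by (auto simp: perm_subgroup_def)
    moreover have "s \<circ> f = (s \<circ> b) \<circ> word_eval g w"
      by (simp add: bw comp_assoc)
    ultimately show ?thesis using bw by blast
  next
    case False
    then obtain e where "s = (if e then g else inv g)"
      using generated_comp by (metis Un_iff insert_iff singletonD)
    then have "s \<circ> f = id \<circ> word_eval g (w @ [(b, e)])"
      by (simp add: bw word_eval_append comp_assoc)
    moreover have "w @ [(b, e)] \<in> lists (G \<times> UNIV)" "id \<in> G"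
      using bw G by (auto simp: perm_subgroup_def)
    ultimately show ?thesis by blast
  qed
qed

lemma countable_generated:
  assumes "perm_subgroup G" "countable G"
  shows "countable (generated (G \<union> {g, inv g}))"
proof -
  have "generated (G \<union> {g, inv g}) \<subseteq> (\<lambda>(b, w). b \<circ> word_eval g w) ` (G \<times> lists (G \<times> UNIV))"
    using generated_word[OF assms(1)] by fastforce
  then show ?thesis
    by (rule countable_subset) (intro countable_image countable_SIGMA countable_lists assms countableI_type)
qed

lemma generated_cofinitary:
  assumes G: "cofinitary_group G" and "bij g"
    and red: "\<And>w. w \<noteq> [] \<Longrightarrow> w \<in> lists (G \<times> UNIV) \<Longrightarrow> cyclically_reduced w
                \<Longrightarrow> finite {k. word_eval g w k = k}"
  shows "cofinitary_group (generated (G \<union> {g, inv g}))"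
proof -
  have pG: "perm_subgroup G" using G by (simp add: cofinitary_group_def)
  then have bijG: "bij f" if "f \<in> G" for f
    using that by (auto simp: perm_subgroup_def Sym_nat_def)
  have "cofinitary_perm f" if f: "f \<in> generated (G \<union> {g, inv g})" for f
  proof -
    obtain b w where bw: "b \<in> G" "w \<in> lists (G \<times> UNIV)" "f = b \<circ> word_eval g w"
      using generated_word[OF pG f] by blast
    have "bij (word_eval g w)"
      using bw bijG by (intro word_eval_bij[OF \<open>bij g\<close>]) auto
    \<comment> \<open>Conjugation carries the outer coefficient \<open>b\<close> to the right end,
      the form treated by \<open>cofinitary_word_eval\<close>.\<close>
    then show ?thesis
      using cofinitary_word_eval[OF G \<open>bij g\<close> red bw(2,1)] bw bijG
      by (auto intro: cofinitary_perm_comp_commute)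
  qed
  moreover have "perm_subgroup (generated (G \<union> {g, inv g}))"
    using pG \<open>bij g\<close>
    by (intro generated_perm_subgroup)
       (auto simp: perm_subgroup_def Sym_nat_def bij_imp_bij_inv inv_inv_eq)
  ultimately show ?thesis by (simp add: cofinitary_group_def)
qed

section \<open>Extending finite partial permutations\<close>

text \<open>The finite classes are filled from the start, so every later extension happens inside an
  infinite class, where there is room to choose.\<close>

definition partial_colour_perm :: "(nat \<Rightarrow> nat) \<Rightarrow> (nat \<times> nat) set \<Rightarrow> bool" where
  "partial_colour_perm c p \<longleftrightarrow> finite p \<and> single_valued p \<and> single_valued (p\<inverse>)
     \<and> (\<forall>(x, y)\<in>p. c x = c y) \<and> {x. finite (c -` {c x})} \<subseteq> Domain p \<inter> Range p"

text \<open>These are the conditions that make \<open>v\<close> pendant once it is joined by a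
  single pair to a point of \<open>B\<close>, where \<open>B\<close> contains the old field.\<close>

definition fresh :: "(nat \<Rightarrow> nat) set \<Rightarrow> nat set \<Rightarrow> nat \<Rightarrow> bool" where
  "fresh F B v \<longleftrightarrow> v \<notin> B \<and> (\<forall>a\<in>F. a \<noteq> id \<longrightarrow> a v \<notin> insert v B \<and> v \<notin> a ` B)"

lemma partial_colour_perm_insert:
  assumes "partial_colour_perm c p" "x \<notin> Domain p" "y \<notin> Range p" "c x = c y"
  shows "partial_colour_perm c (insert (x, y) p)"
  using assms by (auto simp: partial_colour_perm_def single_valued_def)

lemma finite_Field_partial_colour_perm: "partial_colour_perm c p \<Longrightarrow> finite (Field p)"
  by (simp add: partial_colour_perm_def finite_Field)

lemma cofinitary_group_inj: "cofinitary_group G \<Longrightarrow> a \<in> G \<Longrightarrow> inj a"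
  by (auto simp: cofinitary_group_def perm_subgroup_def Sym_nat_def bij_is_inj)

text \<open>Cofinitariness of \<open>G\<close> enters here: nonidentity elements of \<open>F\<close>
  have finitely many fixed points. The other bad points are images and preimages of the finite set
  \<open>B\<close>.\<close>

lemma finite_not_fresh:
  assumes G: "cofinitary_group G" and F: "finite F" "F \<subseteq> G" and B: "finite B"
  shows "finite {v. \<not> fresh F B v}"
proof -
  have "finite (B \<union> (\<Union>a\<in>F - {id}. a -` B \<union> {k. a k = k} \<union> a ` B))"
  proof (intro finite_UnI finite_UN_I B)
    fix a assume a: "a \<in> F - {id}"
    then show "finite (a -` B)"
      using G F B by (intro finite_vimageI cofinitary_group_inj) auto
    show "finite {k. a k = k}"
      using a G F by (auto simp: cofinitary_group_def cofinitary_perm_def)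
  qed (use F B in auto)
  then show ?thesis
    by (rule rev_finite_subset) (auto simp: fresh_def)
qed

lemma infinite_avoid:
  assumes "infinite S" "finite B" shows "\<exists>x\<in>S. x \<notin> B"
  using assms by (meson finite_subset subsetI)

text \<open>Map \<open>k\<close> to a fresh point of its own class. That point is pendant, so no
  closed path with coefficients in \<open>F\<close> uses the new pair.\<close>

lemma extend_domain:
  assumes p: "partial_colour_perm c p" and G: "cofinitary_group G" and F: "finite F" "F \<subseteq> G"
  shows "\<exists>p'. partial_colour_perm c p' \<and> p \<subseteq> p' \<and> k \<in> Domain p' \<and> safe F p p'"
proof (cases "k \<in> Domain p")
  case True
  with p show ?thesis using safe_refl by blast
next
  case False
  let ?B = "insert k (Field p)"
  \<comment> \<open>Finite classes already lie in the domain, so the class of \<open>k\<close> is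
    infinite.\<close>
  have "infinite (c -` {c k})"
    using p False by (auto simp: partial_colour_perm_def)
  moreover have "finite {v. \<not> fresh F ?B v}"
    using finite_not_fresh[OF G F] p by (simp add: finite_Field_partial_colour_perm)
  ultimately have "\<exists>l\<in>c -` {c k}. l \<notin> {v. \<not> fresh F ?B v}"
    by (rule infinite_avoid)
  then obtain l where l: "c l = c k" "fresh F ?B l"
    by auto
  have "safe F p (p \<union> {(k, l)})"
    using l by (intro safe_pendant) (auto simp: pendant_def fresh_def Field_def)
  moreover have "partial_colour_perm c (insert (k, l) p)"
    using l False p by (intro partial_colour_perm_insert) (auto simp: fresh_def Field_def)
  ultimately show ?thesis
    by (intro exI[of _ "insert (k, l) p"]) auto
qed

lemma extend_range:
  assumes p: "partial_colour_perm c p" and G: "cofinitary_group G" and F: "finite F" "F \<subseteq> G"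
  shows "\<exists>p'. partial_colour_perm c p' \<and> p \<subseteq> p' \<and> k \<in> Range p' \<and> safe F p p'"
proof (cases "k \<in> Range p")
  case True
  with p show ?thesis using safe_refl by blast
next
  case False
  let ?B = "insert k (Field p)"
  have "infinite (c -` {c k})"
    using p False by (auto simp: partial_colour_perm_def)
  moreover have "finite {v. \<not> fresh F ?B v}"
    using finite_not_fresh[OF G F] p by (simp add: finite_Field_partial_colour_perm)
  ultimately have "\<exists>l\<in>c -` {c k}. l \<notin> {v. \<not> fresh F ?B v}"
    by (rule infinite_avoid)
  then obtain l where l: "c l = c k" "fresh F ?B l"
    by auto
  have "safe F p (p \<union> {(l, k)})"
    using l by (intro safe_pendant) (auto simp: pendant_def fresh_def Field_def)
  moreover have "partial_colour_perm c (insert (l, k) p)"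
    using l False p by (intro partial_colour_perm_insert) (auto simp: fresh_def Field_def)
  ultimately show ?thesis
    by (intro exI[of _ "insert (l, k) p"]) auto
qed

section \<open>A generic permutation commuting infinitely often with \<open>h\<close>\<close>

locale cofinitary_extension =
  fixes c h :: "nat \<Rightarrow> nat" and G H :: "(nat \<Rightarrow> nat) set"
  assumes finite_range: "finite (range c)"
    and countable_G: "countable G" and G: "cofinitary_group G"
    and H: "cofinitary_group H" and GH: "G \<subseteq> H" and hH: "h \<in> H" and hG: "h \<notin> G"
begin

lemma h_bij: "bij h"
  using H hH by (auto simp: cofinitary_group_def perm_subgroup_def Sym_nat_def)

lemma G_bij: "a \<in> G \<Longrightarrow> bij a"
  using G by (auto simp: cofinitary_group_def perm_subgroup_def Sym_nat_def)

lemma id_G: "id \<in> G"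
  using G by (auto simp: cofinitary_group_def perm_subgroup_def)

text \<open>The coincidences are the fixed points of \<open>inv a \<circ> h\<close>, which lies in
  the cofinitary group \<open>H\<close> and is not the identity because \<open>h\<close> is outside
  \<open>G\<close>.\<close>

lemma finite_coincidence:
  assumes "a \<in> G" shows "finite {k. a k = h k}"
proof -
  have "inv a \<circ> h \<in> H"
    using assms GH hH H by (auto simp: cofinitary_group_def perm_subgroup_def)
  moreover have "inv a \<circ> h \<noteq> id"
  proof
    assume "inv a \<circ> h = id"
    then have "inv a (h k) = k" for k by (metis comp_apply id_apply)
    then have "h k = a k" for k
      using bij_inv_eq_iff[OF G_bij[OF assms], of k "h k"] by simp
    then have "h = a" by (rule ext)
    with assms hG show False by blast
  qed
  ultimately have "finite {k. (inv a \<circ> h) k = k}"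
    using H by (auto simp: cofinitary_group_def cofinitary_perm_def)
  then show ?thesis
    by (rule rev_finite_subset)
       (use bij_inv_eq_iff[OF G_bij[OF assms]] in \<open>auto, metis\<close>)
qed

lemma finite_inverse_coincidence:
  assumes "a \<in> G" shows "finite {k. a (h k) = k}"
proof -
  have "inv a \<in> G"
    using assms G by (auto simp: cofinitary_group_def perm_subgroup_def)
  then have "finite {k. inv a k = h k}"
    by (rule finite_coincidence)
  then show ?thesis
    by (rule rev_finite_subset)
       (use bij_inv_eq_iff[OF G_bij[OF assms]] in \<open>auto, metis\<close>)
qed

text \<open>Pigeonhole on pairs of colours. If \<open>k\<close> and \<open>l\<close> both come from
  this set, then \<open>(k, l)\<close> and \<open>(h k, h l)\<close> preserve colours even when
  \<open>h\<close> does not.\<close>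

lemma infinite_colour_pair:
  obtains i j where "infinite {k. c k = i \<and> c (h k) = j}"
proof -
  have "finite (range (\<lambda>k. (c k, c (h k))))"
    by (rule finite_subset[of _ "range c \<times> range c"]) (use finite_range in auto)
  then have "\<exists>k0. infinite {k\<in>UNIV. (c k, c (h k)) = (c k0, c (h k0))}"
    using pigeonhole_infinite[of UNIV "\<lambda>k. (c k, c (h k))"] by auto
  then show ?thesis using that by auto
qed

lemma infinite_colour:
  assumes "infinite {k. c k = i \<and> c (h k) = j}"
  shows "infinite (c -` {i})" "infinite (c -` {j})"
proof -
  have "{k. c k = i \<and> c (h k) = j} \<subseteq> c -` {i}" by auto
  with assms show "infinite (c -` {i})" using finite_subset by blast
  have "infinite (h ` {k. c k = i \<and> c (h k) = j})"
    using assms finite_imageD inj_on_subset[OF bij_is_inj[OF h_bij]] by blast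
  moreover have "h ` {k. c k = i \<and> c (h k) = j} \<subseteq> c -` {j}" by auto
  ultimately show "infinite (c -` {j})" using finite_subset by blast
qed

text \<open>Adding \<open>(k, l)\<close> and \<open>(h k, h l)\<close> forces the new permutation to
  commute with \<open>h\<close> at \<open>k\<close>. Choosing \<open>l\<close> generic makes
  \<open>l\<close> and \<open>h l\<close> pendant, one on each new pair.\<close>

lemma extend_commuting:
  assumes p: "partial_colour_perm c p" and F: "finite F" "F \<subseteq> G"
    and inf: "infinite {k. c k = i \<and> c (h k) = j}"
  shows "\<exists>p'. partial_colour_perm c p' \<and> p \<subseteq> p' \<and> safe F p p'
     \<and> (\<exists>k\<ge>s. \<exists>l. (k, l) \<in> p' \<and> (h k, h l) \<in> p')"
proof -
  let ?S = "{k. c k = i \<and> c (h k) = j}"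
  have fin: "finite (Field p)"
    using p by (rule finite_Field_partial_colour_perm)
  have hfix: "finite {k. k = h k}"
    using finite_coincidence[OF id_G] by simp
  have "finite ({..<s} \<union> Field p \<union> h -` Field p \<union> {k. k = h k})"
    using fin hfix by (simp add: finite_vimageI bij_is_inj[OF h_bij])
  from infinite_avoid[OF inf this] obtain k where k: "c k = i" "c (h k) = j" "s \<le> k"
      "k \<notin> Field p" "h k \<notin> Field p" "k \<noteq> h k"
    by auto
  let ?B = "{k, h k} \<union> Field p"
  have "finite ?B" using fin by simp
  then have B: "finite {v. \<not> fresh F ?B v}"
    by (rule finite_not_fresh[OF G F])
  \<comment> \<open>Besides both points being fresh, no element of \<open>F\<close> may link
    \<open>l\<close> and \<open>h l\<close>; the coincidence lemmas exclude only finitely many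
    \<open>l\<close> for this.\<close>
  have "finite ({v. \<not> fresh F ?B v} \<union> h -` {v. \<not> fresh F ?B v} \<union> {l. l = h l}
      \<union> (\<Union>a\<in>F. {l. a l = h l} \<union> {l. a (h l) = l}))"
    using F finite_coincidence finite_inverse_coincidence
    by (intro finite_UnI finite_UN_I finite_vimageI bij_is_inj[OF h_bij] B hfix) auto
  from infinite_avoid[OF inf this] obtain l where l: "c l = i" "c (h l) = j"
      "fresh F ?B l" "fresh F ?B (h l)" "l \<noteq> h l"
      "\<And>a. a \<in> F \<Longrightarrow> a l \<noteq> h l \<and> a (h l) \<noteq> l"
    by auto
  let ?q = "{(k, l), (h k, h l)}"
  have l': "l \<notin> ?B" "h l \<notin> ?B"
    using l by (auto simp: fresh_def)
  have Fi: "Field (p \<union> ?q) = ?B \<union> {l, h l}"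
    by (auto simp: Field_def)
  have "pendant F (p \<union> ?q) l"
    using l(3,6) l' unfolding pendant_def Fi by (auto simp: fresh_def) (auto simp: Field_def dest: sym)
  moreover have "pendant F (p \<union> ?q) (h l)"
    using l(4,6) l' l(5)[symmetric] unfolding pendant_def Fi by (auto simp: fresh_def) (auto simp: Field_def dest: sym)
  ultimately have "safe F p (p \<union> ?q)"
    by (intro safe_pendant) auto
  moreover have "partial_colour_perm c (insert (h k, h l) p)"
    using k(2,5) l(2) l' p by (intro partial_colour_perm_insert) (auto simp: Field_def)
  then have "partial_colour_perm c (insert (k, l) (insert (h k, h l) p))"
    using k(1,4,6) l(1,5) l' by (elim partial_colour_perm_insert) (auto simp: Field_def)
  ultimately show ?thesis
    using k(3) by (intro exI[of _ "p \<union> ?q"]) auto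
qed

text \<open>Any \<open>g\<close> extending \<open>p\<close> fixes \<open>k\<close> but moves
  \<open>h k\<close>, so \<open>g (h k)\<close> differs from \<open>h (g k)\<close>. On the finite
  classes \<open>p\<close> starts as the identity.\<close>

lemma non_commuting_start:
  assumes inf: "infinite {k. c k = i \<and> c (h k) = j}"
  shows "\<exists>p k u. partial_colour_perm c p \<and> (k, k) \<in> p \<and> (h k, u) \<in> p \<and> u \<noteq> h k"
proof -
  define Z where "Z = {x. finite (c -` {c x})}"
  have "Z \<subseteq> (\<Union>d\<in>{d\<in>range c. finite (c -` {d})}. c -` {d})"
    by (auto simp: Z_def)
  then have "finite Z"
    by (rule finite_subset) (use finite_range in auto)
  have "finite {k. k = h k}"
    using finite_coincidence[OF id_G] by simp
  from infinite_avoid[OF inf this] obtain k where k: "c k = i" "c (h k) = j" "h k \<noteq> k"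
    by auto
  \<comment> \<open>\<open>u \<noteq> k\<close> keeps the relation injective, since \<open>k\<close>
    is already a value; \<open>u \<noteq> h k\<close> breaks commutation.\<close>
  obtain u where u: "c u = j" "u \<noteq> k" "u \<noteq> h k"
    using infinite_avoid[OF infinite_colour(2)[OF inf], of "{k, h k}"] by auto
  have nZ: "x \<notin> Z" if "c x = i \<or> c x = j" for x
    using that infinite_colour[OF inf] by (auto simp: Z_def)
  have "partial_colour_perm c (Id_on Z)"
    using \<open>finite Z\<close> by (auto simp: partial_colour_perm_def Z_def single_valued_def Id_on_def)
  then have "partial_colour_perm c (insert (k, k) (insert (h k, u) (Id_on Z)))"
    using k u nZ by (intro partial_colour_perm_insert) auto
  with u show ?thesis by blast
qed

text \<open>Stage \<open>s\<close> puts \<open>s\<close> into domain and range and adds a commuting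
  point beyond \<open>s\<close>, all safely for the finite set \<open>F s\<close>. The sets
  \<open>F s\<close> exhaust the countable group \<open>G\<close>.\<close>

lemma extension_sequence:
  obtains P :: "nat \<Rightarrow> (nat \<times> nat) set" and F :: "nat \<Rightarrow> (nat \<Rightarrow> nat) set"
    and k0 u0 :: nat where "\<And>s. partial_colour_perm c (P s)" "mono P" "mono F" "(\<Union>s. F s) = G"
    "\<And>s. safe (F s) (P s) (P (Suc s))" "\<And>s. s \<in> Domain (P (Suc s))" "\<And>s. s \<in> Range (P (Suc s))"
    "\<And>s. \<exists>k\<ge>s. \<exists>l. (k, l) \<in> P (Suc s) \<and> (h k, h l) \<in> P (Suc s)"
    "(k0, k0) \<in> P 0" "(h k0, u0) \<in> P 0" "u0 \<noteq> h k0"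
proof -
  obtain i j where ij: "infinite {k. c k = i \<and> c (h k) = j}"
    by (rule infinite_colour_pair)
  obtain p0 k0 u0 where p0: "partial_colour_perm c p0" "(k0, k0) \<in> p0" "(h k0, u0) \<in> p0" "u0 \<noteq> h k0"
    using non_commuting_start[OF ij] by blast
  define F where "F s = from_nat_into G ` {..s}" for s :: nat
  have G_ne: "G \<noteq> {}" using id_G by auto
  have F: "finite (F s)" "F s \<subseteq> G" for s
    using from_nat_into[OF G_ne] by (auto simp: F_def)
  have "(\<Union>s. F s) = range (from_nat_into G)"
    by (auto simp: F_def)
  then have FU: "(\<Union>s. F s) = G"
    using range_from_nat_into[OF G_ne countable_G] by simp
  have "mono F"
    by (auto simp: F_def mono_def)
  have "\<exists>p'. (partial_colour_perm c p' \<and> p0 \<subseteq> p') \<and> (p \<subseteq> p' \<and> safe (F s) p p' \<and> s \<in> Domain p' \<and> s \<in> Range p'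
      \<and> (\<exists>k\<ge>s. \<exists>l. (k, l) \<in> p' \<and> (h k, h l) \<in> p'))"
    if p: "partial_colour_perm c p \<and> p0 \<subseteq> p" for p s
  proof -
    obtain p1 where p1: "partial_colour_perm c p1" "p \<subseteq> p1" "s \<in> Domain p1" "safe (F s) p p1"
      using extend_domain[OF conjunct1[OF p] G F(1,2)[of s], of s] by blast
    obtain p2 where p2: "partial_colour_perm c p2" "p1 \<subseteq> p2" "s \<in> Range p2" "safe (F s) p1 p2"
      using extend_range[OF p1(1) G F(1,2)[of s], of s] by blast
    obtain p3 where p3: "partial_colour_perm c p3" "p2 \<subseteq> p3" "safe (F s) p2 p3"
        "\<exists>k\<ge>s. \<exists>l. (k, l) \<in> p3 \<and> (h k, h l) \<in> p3"
      using extend_commuting[OF p2(1) F(1,2)[of s] ij, of s] by blast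
    have "safe (F s) p p3"
      using p1 p2 p3 safe_trans by blast
    moreover have "s \<in> Domain p3" "s \<in> Range p3"
      using p1 p2 p3 by blast+
    ultimately show ?thesis
      using p p1 p2 p3 by (intro exI[of _ p3]) auto
  qed
  then have "\<exists>P. \<forall>s. (partial_colour_perm c (P s) \<and> p0 \<subseteq> P s) \<and> (P s \<subseteq> P (Suc s)
      \<and> safe (F s) (P s) (P (Suc s)) \<and> s \<in> Domain (P (Suc s)) \<and> s \<in> Range (P (Suc s))
      \<and> (\<exists>k\<ge>s. \<exists>l. (k, l) \<in> P (Suc s) \<and> (h k, h l) \<in> P (Suc s)))"
    using p0(1)
    by (intro dependent_nat_choice[where P = "\<lambda>s p. partial_colour_perm c p \<and> p0 \<subseteq> p"
          and Q = "\<lambda>s p p'. p \<subseteq> p' \<and> safe (F s) p p' \<and> s \<in> Domain p' \<and> s \<in> Range p'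
            \<and> (\<exists>k\<ge>s. \<exists>l. (k, l) \<in> p' \<and> (h k, h l) \<in> p')"]) auto
  then obtain P where P: "\<And>s. partial_colour_perm c (P s)" "\<And>s. p0 \<subseteq> P s" "\<And>s. P s \<subseteq> P (Suc s)"
      "\<And>s. safe (F s) (P s) (P (Suc s))" "\<And>s. s \<in> Domain (P (Suc s))" "\<And>s. s \<in> Range (P (Suc s))"
      "\<And>s. \<exists>k\<ge>s. \<exists>l. (k, l) \<in> P (Suc s) \<and> (h k, h l) \<in> P (Suc s)"
    by blast
  have "mono P" using P(3) by (simp add: mono_iff_le_Suc)
  show thesis
    using that[OF P(1) \<open>mono P\<close> \<open>mono F\<close> FU P(4-7)] p0 P(2) by blast
qed

end

section \<open>The limit permutation and its fixed points\<close>

lemma edge_mono: "edge p l x y \<Longrightarrow> p \<subseteq> q \<Longrightarrow> edge q l x y"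
  by (auto simp: edge_def split: if_splits)

text \<open>One period has finitely many edges, so it lies in a single stage of the chain, which may
  be taken as late as desired.\<close>

lemma closed_path_UN:
  fixes P :: "nat \<Rightarrow> (nat \<times> nat) set"
  assumes "mono P" "0 < r" "closed_path (\<Union>s. P s) r w x"
  shows "\<exists>t\<ge>s. closed_path (P t) r w x"
proof -
  have "\<exists>t. edge (P t) (w i) (x i) (x (Suc i))" for i
    using assms(3) by (auto simp: closed_path_def edge_def split: if_splits)
  then obtain T where T: "\<And>i. edge (P (T i)) (w i) (x i) (x (Suc i))"
    by metis
  define t where "t = Max (insert s (T ` {..<r}))"
  have per: "w (i + r) = w i" "x (i + r) = x i" for i
    using assms(3) by (auto simp: closed_path_def)
  have "edge (P t) (w i) (x i) (x (Suc i))" for i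
  proof (induction i rule: less_induct)
    case (less i)
    show ?case
    proof (cases "i < r")
      case True
      then have "T i \<le> t" by (simp add: t_def)
      then show ?thesis
        using edge_mono[OF T monoD[OF \<open>mono P\<close>]] by blast
    next
      case False
      then obtain i' where i': "i = i' + r"
        by (metis add.commute le_Suc_ex not_less)
      then show ?thesis
        using less[of i'] \<open>0 < r\<close> per[of i'] per(2)[of "Suc i'"] by simp
    qed
  qed
  moreover have "s \<le> t" by (simp add: t_def)
  ultimately show ?thesis
    using per by (auto simp: closed_path_def)
qed

text \<open>The path visits the images of \<open>k\<close> under the prefixes of \<open>w\<close>,
  and it closes up because \<open>k\<close> is fixed.\<close>

lemma closed_path_word:
  assumes g: "bij g" "\<And>x y. (x, y) \<in> U \<longleftrightarrow> y = g x" and "w \<noteq> []" and k: "word_eval g w k = k"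
  shows "closed_path U (length w) (\<lambda>i. w ! (i mod length w))
           (\<lambda>i. word_eval g (take (i mod length w) w) k)"
  unfolding closed_path_def
proof (intro allI conjI)
  fix i
  let ?r = "length w" and ?x = "\<lambda>i. word_eval g (take i w) k"
  define j where "j = i mod ?r"
  have j: "j < ?r" using \<open>w \<noteq> []\<close> by (simp add: j_def)
  \<comment> \<open>After the last letter the index wraps to \<open>0\<close>, and the equation
    becomes the fixed point equation for \<open>k\<close>.\<close>
  have "?x (Suc i mod ?r) = ?x (Suc j)"
    using j k by (cases "Suc j = ?r") (auto simp: j_def mod_Suc)
  moreover have "edge U (w ! j) (?x j) (?x (Suc j))"
  proof -
    obtain a e where "w ! j = (a, e)" by force
    then show ?thesis
      using j g by (simp add: take_Suc_conv_app_nth word_eval_append edge_def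
          bij_is_surj surj_f_inv_f)
  qed
  ultimately show "edge U (w ! (i mod ?r)) (?x (i mod ?r)) (?x (Suc i mod ?r))"
    by (simp add: j_def)
qed simp_all

lemma permutation_of_chain:
  assumes "\<And>s. partial_colour_perm c (P s)" "mono P"
    "\<And>s. s \<in> Domain (P (Suc s))" "\<And>s. s \<in> Range (P (Suc s))"
  obtains g where "bij g" "\<And>x y. (x, y) \<in> (\<Union>s. P s) \<longleftrightarrow> y = g x" "c \<circ> g = c"
proof -
  let ?U = "\<Union>s. P s"
  have common: "\<exists>t. e \<in> P t \<and> e' \<in> P t" if "e \<in> P s" "e' \<in> P s'" for e e' s s'
    using that monoD[OF assms(2), of s "max s s'"] monoD[OF assms(2), of s' "max s s'"]
    by (intro exI[of _ "max s s'"]) auto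
  have fn: "y = z" if "(x, y) \<in> ?U" "(x, z) \<in> ?U" for x y z
    using that common assms(1) unfolding partial_colour_perm_def single_valued_def by blast
  have inj: "x = z" if "(x, y) \<in> ?U" "(z, y) \<in> ?U" for x y z
    using that common assms(1) unfolding partial_colour_perm_def single_valued_def by blast
  define g where "g x = (SOME y. (x, y) \<in> ?U)" for x
  have gU: "(x, g x) \<in> ?U" for x
  proof -
    have "\<exists>y. (x, y) \<in> ?U" using assms(3)[of x] by blast
    then show ?thesis unfolding g_def by (rule someI_ex)
  qed
  then have gr: "(x, y) \<in> ?U \<longleftrightarrow> y = g x" for x y
    using fn by blast
  have "bij g"
  proof (rule bijI)
    show "inj g" using gU inj by (metis injI)
    have "\<exists>x. y = g x" for y
      using assms(4)[of y] gr by blast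
    then show "surj g" by blast
  qed
  moreover have "c (g x) = c x" for x
    using gU[of x] assms(1) by (fastforce simp: partial_colour_perm_def)
  ultimately show thesis
    using that gr by (auto simp: fun_eq_iff)
qed

text \<open>A fixed point of a cyclically reduced word gives a closed path at some late stage.
  Safety pulls it back to the stage from which all coefficients are allowed, and the field of that
  stage is finite.\<close>

lemma (in cofinitary_extension) exists_commuting_perm:
  obtains g where "bij g" "c \<circ> g = c" "cofinitary_group (generated (G \<union> {g, inv g}))"
    "g \<circ> h \<noteq> h \<circ> g" "infinite {k. g (h k) = h (g k)}"
proof -
  obtain P F k0 u0 where P: "\<And>s. partial_colour_perm c (P s)" "mono P" "mono F" "(\<Union>s. F s) = G"
    "\<And>s. safe (F s) (P s) (P (Suc s))" "\<And>s. s \<in> Domain (P (Suc s))" "\<And>s. s \<in> Range (P (Suc s))"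
    "\<And>s. \<exists>k\<ge>s. \<exists>l. (k, l) \<in> P (Suc s) \<and> (h k, h l) \<in> P (Suc s)"
    "(k0, k0) \<in> P 0" "(h k0, u0) \<in> P 0" "u0 \<noteq> h k0"
    using extension_sequence by metis
  obtain g where g: "bij g" "\<And>x y. (x, y) \<in> (\<Union>s. P s) \<longleftrightarrow> y = g x" "c \<circ> g = c"
    using permutation_of_chain[OF P(1,2,6,7)] by metis
  have gP: "y = g x" if "(x, y) \<in> P s" for x y s
    using g(2) that by blast
  have "g (h k0) \<noteq> h (g k0)"
    using gP[OF P(9)] gP[OF P(10)] P(11) by simp
  then have "g \<circ> h \<noteq> h \<circ> g" by (metis comp_apply)
  have "\<exists>k\<ge>s. g (h k) = h (g k)" for s
    using P(8)[of s] gP by metis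
  then have inf: "infinite {k. g (h k) = h (g k)}"
    by (simp add: infinite_nat_iff_unbounded_le)
  have "finite {k. word_eval g w k = k}"
    if w: "w \<noteq> []" "w \<in> lists (G \<times> UNIV)" "cyclically_reduced w" for w
  proof -
    let ?r = "length w" and ?w = "\<lambda>i. w ! (i mod length w)"
    have "subset.chain UNIV (range F)"
      using P(3) by (auto simp: subset_chain_def mono_def) (metis nat_le_linear subset_iff)
    moreover have "fst ` set w \<subseteq> (\<Union>s. F s)"
      unfolding P(4) using w(2) by auto
    ultimately obtain B where "B \<in> range F" "fst ` set w \<subseteq> B"
      using finite_subset_Union_chain[of "fst ` set w" "range F" UNIV] by blast
    then obtain s where "fst ` set w \<subseteq> F s" by blast
    then have s: "fst (?w i) \<in> F t" if "s \<le> t" for i t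
      using w(1) monoD[OF P(3) that] by force
    have red: "reduced ?w" using w(3) by (simp add: cyclically_reduced_def)
    \<comment> \<open>As \<open>F\<close> increases, the coefficients of \<open>w\<close> remain
      allowed from stage \<open>s\<close> on, so safety removes one stage at a time.\<close>
    have down: "closed_path (P s) ?r ?w x" if "closed_path (P (s + d)) ?r ?w x" for d x
      using that
    proof (induction d)
      case (Suc d)
      then have "closed_path (P (s + d)) ?r ?w x"
        using P(5)[of "s + d"] w(1) red s[of "s + d"] by (simp add: safe_def)
      with Suc.IH show ?case by blast
    qed simp
    have "fst (?w 0) k \<in> Field (P s)" if k: "word_eval g w k = k" for k
    proof -
      let ?x = "\<lambda>i. word_eval g (take (i mod ?r) w) k"
      have "closed_path (\<Union>s. P s) ?r ?w ?x"
        by (rule closed_path_word[OF g(1,2) w(1) k])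
      then obtain t where "s \<le> t" "closed_path (P t) ?r ?w ?x"
        using closed_path_UN[OF P(2)] w(1) by blast
      then have "closed_path (P s) ?r ?w ?x"
        using down[of "t - s"] by simp
      then have "edge (P s) (?w 0) (?x 0) (?x (Suc 0))"
        unfolding closed_path_def by blast
      then show ?thesis
        by (auto dest: edge_Field)
    qed
    then have "{k. word_eval g w k = k} \<subseteq> fst (?w 0) -` Field (P s)" by auto
    moreover have "fst (?w 0) \<in> G"
      using s[of s 0] P(4) by blast
    then have "finite (fst (?w 0) -` Field (P s))"
      using finite_Field_partial_colour_perm[OF P(1)] cofinitary_group_inj[OF G]
      by (intro finite_vimageI) auto
    ultimately show ?thesis by (rule finite_subset)
  qed
  then have "cofinitary_group (generated (G \<union> {g, inv g}))"
    using G g(1) by (intro generated_cofinitary) auto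
  with that g(1,3) inf \<open>g \<circ> h \<noteq> h \<circ> g\<close> show thesis by blast
qed

section \<open>Deciding a single permutation\<close>

lemma generated_colour:
  assumes "bij g" "c \<circ> g = c" "\<And>f. f \<in> G \<Longrightarrow> c \<circ> f = c" "f \<in> generated (G \<union> {g, inv g})"
  shows "c \<circ> f = c"
proof -
  have "c \<circ> inv g = c \<circ> g \<circ> inv g" using assms(2) by simp
  also have "\<dots> = c"
    using assms(1) by (simp add: comp_assoc surj_iff[THEN iffD1] bij_is_surj)
  finally have g: "c \<circ> inv g = c" .
  from assms(4) show ?thesis
  proof induction
    case (generated_comp f s)
    then have "c \<circ> s = c" using g assms by auto
    with generated_comp.IH show ?case by (metis comp_assoc)
  qed simp
qed

text \<open>If no larger cofinitary group contains \<open>h\<close> as a new element,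
  \<open>G\<close> itself will do. Otherwise the adjoined \<open>g\<close> ensures that no
  cofinitary group contains both \<open>G'\<close> and \<open>h\<close>.\<close>

lemma extension_deciding_perm:
  fixes c :: "nat \<Rightarrow> nat"
  assumes c: "finite (range c)" and G: "countable G" "cofinitary_group G" "\<And>f. f \<in> G \<Longrightarrow> c \<circ> f = c"
  shows "\<exists>G'. countable G' \<and> cofinitary_group G' \<and> (\<forall>f\<in>G'. c \<circ> f = c) \<and> G \<subseteq> G'
     \<and> (\<forall>H. cofinitary_group H \<and> G' \<subseteq> H \<and> h \<in> H \<longrightarrow> h \<in> G')"
proof (cases "\<exists>H. cofinitary_group H \<and> G \<subseteq> H \<and> h \<in> H \<and> h \<notin> G")
  case False
  with G show ?thesis by blast
next
  case True
  then obtain H where "cofinitary_group H" "G \<subseteq> H" "h \<in> H" "h \<notin> G"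
    by blast
  then interpret cofinitary_extension c h G H
    using c G(1,2) by unfold_locales
  obtain g where g: "bij g" "c \<circ> g = c" "cofinitary_group (generated (G \<union> {g, inv g}))"
    "g \<circ> h \<noteq> h \<circ> g" "infinite {k. g (h k) = h (g k)}"
    using exists_commuting_perm by metis
  let ?G' = "generated (G \<union> {g, inv g})"
  have "\<not> (cofinitary_group H' \<and> ?G' \<subseteq> H' \<and> h \<in> H')" for H'
  proof
    assume H': "cofinitary_group H' \<and> ?G' \<subseteq> H' \<and> h \<in> H'"
    then have gH: "g \<in> H'" using generated_incl[of g "G \<union> {g, inv g}"] by blast
    \<comment> \<open>This commutator fixes exactly the points where \<open>g\<close> and
      \<open>h\<close> commute: infinitely many, but not all.\<close>
    let ?f = "inv (h \<circ> g) \<circ> (g \<circ> h)"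
    have "?f \<in> H'"
      using gH H' by (auto simp: cofinitary_group_def perm_subgroup_def)
    have bij: "bij (h \<circ> g)" using h_bij g(1) by (rule bij_comp[rotated])
    have f: "?f k = l \<longleftrightarrow> g (h k) = h (g l)" for k l
      using bij_inv_eq_iff[OF bij, of l "g (h k)"] by auto
    then have "{k. ?f k = k} = {k. g (h k) = h (g k)}" by (simp only: f)
    with g(5) \<open>?f \<in> H'\<close> H' have "?f = id"
      by (auto simp: cofinitary_group_def cofinitary_perm_def)
    then have "g (h k) = h (g k)" for k
      using f[of k k] by simp
    with g(4) show False by (simp add: fun_eq_iff)
  qed
  moreover have "countable ?G'"
    using countable_generated[OF _ countable_G] G by (simp add: cofinitary_group_def)
  moreover have "\<forall>f\<in>?G'. c \<circ> f = c"
    using generated_colour[OF g(1,2) assms(4)] by blast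
  moreover have "G \<subseteq> ?G'"
    using generated_incl[of _ "G \<union> {g, inv g}"] by blast
  ultimately show ?thesis
    using g(3) by (intro exI[of _ ?G']) simp
qed

section \<open>Transfinite recursion\<close>

lemma cofinitary_group_Union_chain:
  assumes "C \<noteq> {}" "\<And>X. X \<in> C \<Longrightarrow> cofinitary_group X"
    and chain: "\<And>X Y. X \<in> C \<Longrightarrow> Y \<in> C \<Longrightarrow> X \<subseteq> Y \<or> Y \<subseteq> X"
  shows "cofinitary_group (\<Union>C)"
proof -
  have gr: "X \<subseteq> Sym_nat" "id \<in> X" "\<And>f g. f \<in> X \<Longrightarrow> g \<in> X \<Longrightarrow> f \<circ> g \<in> X"
      "\<And>f. f \<in> X \<Longrightarrow> inv f \<in> X" "\<And>f. f \<in> X \<Longrightarrow> cofinitary_perm f" if "X \<in> C" for X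
    using assms(2)[OF that] by (auto simp: cofinitary_group_def perm_subgroup_def)
  have "f \<circ> g \<in> \<Union>C" if "f \<in> X" "X \<in> C" "g \<in> Y" "Y \<in> C" for f g X Y
    using that chain[of X Y] gr(3)[of X] gr(3)[of Y] by blast
  then have "\<forall>f\<in>\<Union>C. \<forall>g\<in>\<Union>C. f \<circ> g \<in> \<Union>C" by blast
  moreover have "\<Union>C \<subseteq> Sym_nat" "\<forall>f\<in>\<Union>C. cofinitary_perm f"
    using gr(1,5) by blast+
  moreover have "id \<in> \<Union>C" "\<forall>f\<in>\<Union>C. inv f \<in> \<Union>C"
    using gr(2,4) \<open>C \<noteq> {}\<close> by blast+
  ultimately show ?thesis
    by (simp only: cofinitary_group_def perm_subgroup_def simp_thms)
qed

text \<open>A cardinal well-order has proper initial segments of strictly smaller cardinality, and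
  under CH such sets of sets of naturals are countable.\<close>

lemma CH_well_order:
  assumes "CH"
  obtains R :: "nat set rel" where "wf R" "trans R" "\<And>a b. a \<noteq> b \<Longrightarrow> (a, b) \<in> R \<or> (b, a) \<in> R"
    "\<And>a. countable {b. (b, a) \<in> R}"
proof -
  let ?r = "card_of (UNIV :: nat set set)"
  have wo: "well_order_on UNIV ?r" by (rule card_of_well_order_on)
  then have lin: "linear_order ?r" and wf: "wf (?r - Id)"
    by (auto simp: well_order_on_def)
  have "trans (?r - Id)"
    using lin by (intro trans_diff_Id) (auto simp: linear_order_on_def partial_order_on_def preorder_on_def)
  moreover have "(a, b) \<in> ?r - Id \<or> (b, a) \<in> ?r - Id" if "a \<noteq> b" for a b
    using lin that by (auto simp: linear_order_on_def total_on_def)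
  moreover have "countable {b. (b, a) \<in> ?r - Id}" for a
  proof -
    have "ordLess2 (card_of (underS ?r a)) ?r"
      by (rule card_of_underS[OF card_of_Card_order]) (simp add: Field_card_of)
    then have "\<not> underS ?r a \<approx> (UNIV :: nat set set)"
      by (simp add: eqpoll_iff_card_of_ordIso not_ordLess_ordIso)
    then have "countable (underS ?r a)"
      using assms by (auto simp: CH_def)
    moreover have "{b. (b, a) \<in> ?r - Id} = underS ?r a"
      by (auto simp: underS_def)
    ultimately show ?thesis by simp
  qed
  ultimately show thesis using that wf by blast
qed

text \<open>A function is coded by its graph under \<open>prod_encode\<close>; thus a well-order of
  \<open>nat set\<close> lists all permutations.\<close>

lemma nat_set_codes_functions: "\<exists>D :: nat set \<Rightarrow> nat \<Rightarrow> nat. surj D"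
proof -
  define D :: "nat set \<Rightarrow> nat \<Rightarrow> nat" where "D A k = (THE j. prod_encode (k, j) \<in> A)" for A k
  have "D {prod_encode (k, h k) | k. True} = h" for h
    by (rule ext) (auto simp: D_def)
  then show ?thesis by (intro exI surjI)
qed

text \<open>Stage \<open>a\<close> joins \<open>G0\<close> with the countably many earlier stages
  and then decides \<open>D a\<close>. Any member of a larger cofinitary group is some
  \<open>D a\<close>, hence already lies in \<open>K a\<close>.\<close>

lemma maximal_cofinitary_extension:
  fixes c :: "nat \<Rightarrow> nat"
  assumes "CH" and c: "finite (range c)"
    and G0: "countable G0" "cofinitary_group G0" "\<forall>f\<in>G0. c \<circ> f = c"
  shows "\<exists>G. maximal_cofinitary_group G \<and> G0 \<subseteq> G \<and> (\<forall>f\<in>G. c \<circ> f = c)"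
proof -
  obtain R :: "nat set rel" where R: "wf R" "trans R"
      "\<And>a b. a \<noteq> b \<Longrightarrow> (a, b) \<in> R \<or> (b, a) \<in> R" "\<And>a. countable {b. (b, a) \<in> R}"
    using CH_well_order[OF \<open>CH\<close>] by metis
  obtain D :: "nat set \<Rightarrow> nat \<Rightarrow> nat" where D: "surj D"
    using nat_set_codes_functions by blast
  define good where "good G \<longleftrightarrow> countable G \<and> cofinitary_group G \<and> (\<forall>f\<in>G. c \<circ> f = c)" for G
  define decides where "decides h G \<longleftrightarrow> (\<forall>H. cofinitary_group H \<and> G \<subseteq> H \<and> h \<in> H \<longrightarrow> h \<in> G)" for h G
  define step where "step G h = (SOME G'. good G' \<and> G \<subseteq> G' \<and> decides h G')" for G h
  have step: "good (step G h) \<and> G \<subseteq> step G h \<and> decides h (step G h)" if "good G" for G h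
  proof -
    have "\<exists>G'. good G' \<and> G \<subseteq> G' \<and> decides h G'"
      using that extension_deciding_perm[OF c, of G h] unfolding good_def decides_def by metis
    then show ?thesis unfolding step_def by (rule someI_ex)
  qed
  define K where "K = wfrec R (\<lambda>f a. step (\<Union>(insert G0 (f ` {b. (b, a) \<in> R}))) (D a))"
  have K: "K a = step (\<Union>(insert G0 (K ` {b. (b, a) \<in> R}))) (D a)" for a
  proof -
    have "cut K R a ` {b. (b, a) \<in> R} = K ` {b. (b, a) \<in> R}"
      by (rule image_cong) (auto simp: cut_apply)
    then show ?thesis
      unfolding K_def by (subst wfrec[OF R(1)]) (simp only:)
  qed
  \<comment> \<open>Inclusion of all earlier stages is part of the invariant: it makes the stages a
    chain, whose unions are again cofinitary groups.\<close>
  have main: "good (K a) \<and> G0 \<subseteq> K a \<and> (\<forall>b. (b, a) \<in> R \<longrightarrow> K b \<subseteq> K a) \<and> decides (D a) (K a)" for a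
  proof (induction a rule: wf_induct_rule[OF R(1)])
    case (1 a)
    let ?C = "insert G0 (K ` {b. (b, a) \<in> R})"
    have IH: "good (K b)" "G0 \<subseteq> K b" "\<And>d. (d, b) \<in> R \<Longrightarrow> K d \<subseteq> K b" if "(b, a) \<in> R" for b
      using 1[OF that] by blast+
    have goodC: "good X" if "X \<in> ?C" for X
      using that IH(1) G0 unfolding good_def by blast
    have "cofinitary_group (\<Union>?C)"
    proof (rule cofinitary_group_Union_chain)
      show "cofinitary_group X" if "X \<in> ?C" for X
        using goodC[OF that] by (simp add: good_def)
      have "K b \<subseteq> K b' \<or> K b' \<subseteq> K b" if "(b, a) \<in> R" "(b', a) \<in> R" for b b'
        using that IH(3) R(3)[of b b'] by blast
      then show "X \<subseteq> Y \<or> Y \<subseteq> X" if "X \<in> ?C" "Y \<in> ?C" for X Y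
        using that IH(2) by blast
    qed simp
    moreover have "countable (\<Union>X\<in>?C. X)"
    proof (rule countable_UN)
      show "countable ?C" using R(4) by simp
      show "countable X" if "X \<in> ?C" for X
        using goodC[OF that] by (simp add: good_def)
    qed
    then have "countable (\<Union>?C)" by simp
    moreover have "\<forall>f\<in>\<Union>?C. c \<circ> f = c"
      using goodC unfolding good_def by blast
    ultimately have "good (\<Union>?C)" unfolding good_def by blast
    from step[OF this, of "D a"] show ?case
      unfolding K[of a, symmetric] by auto
  qed
  let ?C = "insert G0 (range K)"
  have goodC: "good X" if "X \<in> ?C" for X
    using that main G0 unfolding good_def by blast
  have "cofinitary_group (\<Union>?C)"
  proof (rule cofinitary_group_Union_chain)
    show "cofinitary_group X" if "X \<in> ?C" for X
      using goodC[OF that] by (simp add: good_def)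
    have "K b \<subseteq> K b' \<or> K b' \<subseteq> K b" for b b'
      using main R(3)[of b b'] by blast
    then show "X \<subseteq> Y \<or> Y \<subseteq> X" if "X \<in> ?C" "Y \<in> ?C" for X Y
      using that main by blast
  qed simp
  moreover have "H \<subseteq> \<Union>?C" if H: "cofinitary_group H" "\<Union>?C \<subseteq> H" for H
  proof
    fix h assume "h \<in> H"
    obtain a where "D a = h" using D by (metis surjD)
    then have "decides h (K a)" using main by blast
    moreover have "K a \<subseteq> H" using H(2) by blast
    ultimately have "h \<in> K a"
      using H(1) \<open>h \<in> H\<close> unfolding decides_def by blast
    then show "h \<in> \<Union>?C" by blast
  qed
  ultimately have "maximal_cofinitary_group (\<Union>?C)"
    unfolding maximal_cofinitary_group_def by blast
  moreover have "\<forall>f\<in>\<Union>?C. c \<circ> f = c"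
    using goodC unfolding good_def by blast
  ultimately show ?thesis by (intro exI[of _ "\<Union>?C"]) auto
qed

section \<open>The initial group and the orbits\<close>

definition colour :: "nat \<Rightarrow> nat \<Rightarrow> nat \<Rightarrow> nat" where
  "colour m n k = (if k < m then k else m + (k - m) mod n)"

text \<open>On each residue class above \<open>m\<close> this is the translation by \<open>z\<close>, transported from the integers.\<close>

definition shift :: "nat \<Rightarrow> nat \<Rightarrow> int \<Rightarrow> nat \<Rightarrow> nat" where
  "shift m n z k = (if k < m then k
     else m + (n * int_encode (int_decode ((k - m) div n) + z) + (k - m) mod n))"

lemma shift_add: "n \<noteq> 0 \<Longrightarrow> shift m n z \<circ> shift m n w = shift m n (w + z)"
  by (rule ext) (simp add: shift_def add.assoc)

lemma shift_0: "shift m n 0 = id"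
  by (rule ext) (simp add: shift_def)

lemma shift_bij: "n \<noteq> 0 \<Longrightarrow> bij (shift m n z)"
  by (rule o_bij[of "shift m n (- z)"]) (simp_all add: shift_add shift_0)

lemma shift_inv: "n \<noteq> 0 \<Longrightarrow> inv (shift m n z) = shift m n (- z)"
  by (rule inv_unique_comp) (simp_all add: shift_add shift_0)

lemma colour_shift: "n \<noteq> 0 \<Longrightarrow> colour m n \<circ> shift m n z = colour m n"
  by (rule ext) (simp add: shift_def colour_def)

text \<open>Comparing quotients by \<open>n\<close> and decoding gives an integer equal to its
  translate by \<open>z\<close>. So the fixed points of nontrivial shifts lie below
  \<open>m\<close>, and the initial group is cofinitary.\<close>

lemma shift_fixpoint:
  assumes "n \<noteq> 0" "shift m n z k = k" "m \<le> k" shows "z = 0"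
proof -
  have "k - m = n * int_encode (int_decode ((k - m) div n) + z) + (k - m) mod n"
    using assms(2,3) by (simp add: shift_def)
  then have "n * ((k - m) div n) = n * int_encode (int_decode ((k - m) div n) + z)"
    by (metis add_right_cancel mult_div_mod_eq)
  then have "int_encode (int_decode ((k - m) div n) + z) = (k - m) div n"
    using \<open>n \<noteq> 0\<close> by simp
  then have "int_decode ((k - m) div n) + z = int_decode ((k - m) div n)"
    by (metis int_encode_inverse)
  then show ?thesis by simp
qed

lemma shift_transitive:
  assumes "n \<noteq> 0" "colour m n k = colour m n l" shows "\<exists>z. shift m n z k = l"
proof (cases "k < m")
  case True
  with assms show ?thesis by (auto simp: colour_def shift_def split: if_splits)
next
  case False
  with assms have l: "m \<le> l" "(k - m) mod n = (l - m) mod n"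
    by (auto simp: colour_def split: if_splits)
  \<comment> \<open>The difference of the integer coordinates of \<open>l\<close> and
    \<open>k\<close> within their common class.\<close>
  let ?z = "int_decode ((l - m) div n) - int_decode ((k - m) div n)"
  have "shift m n ?z k = l"
    using False l by (simp add: shift_def)
  then show ?thesis ..
qed

lemma cofinitary_group_shifts:
  assumes "n \<noteq> 0" shows "cofinitary_group (range (shift m n))"
proof -
  have "cofinitary_perm (shift m n z)" for z
  proof (cases "z = 0")
    case False
    then have "k < m" if "shift m n z k = k" for k
      using shift_fixpoint[OF assms that] by (cases "k < m") auto
    then have "{k. shift m n z k = k} \<subseteq> {..<m}" by blast
    then show ?thesis
      by (auto simp: cofinitary_perm_def intro: finite_subset)
  qed (simp add: shift_0 cofinitary_perm_def)
  moreover have "id \<in> range (shift m n)"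
    using shift_0[of m n] by (metis rangeI)
  ultimately show ?thesis
    using assms by (auto simp: cofinitary_group_def perm_subgroup_def Sym_nat_def
        shift_bij shift_add shift_inv)
qed

text \<open>Preservation of colours keeps the orbit inside the class, and the shifts in
  \<open>G\<close> already act transitively on it.\<close>

lemma orbit_colour:
  assumes "n \<noteq> 0" "range (shift m n) \<subseteq> G" "\<forall>f\<in>G. colour m n \<circ> f = colour m n"
  shows "orbit G k = colour m n -` {colour m n k}"
proof
  show "orbit G k \<subseteq> colour m n -` {colour m n k}"
    using assms(3) by (auto simp: orbit_def fun_eq_iff)
  show "colour m n -` {colour m n k} \<subseteq> orbit G k"
  proof
    fix l assume "l \<in> colour m n -` {colour m n k}"
    then obtain z where "shift m n z k = l"
      using shift_transitive[OF \<open>n \<noteq> 0\<close>, of m k l] by auto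
    then show "l \<in> orbit G k"
      using assms(2) by (auto simp: orbit_def)
  qed
qed

section \<open>Counting the orbits\<close>

lemma range_colour:
  assumes "n \<noteq> 0" shows "range (colour m n) = {..<m + n}"
proof -
  have "colour m n k = k" if "k < m + n" for k
    using that by (auto simp: colour_def)
  then have "{..<m + n} \<subseteq> range (colour m n)"
    by (metis lessThan_iff rangeI subsetI)
  moreover have "colour m n k < m + n" for k
    using assms by (simp add: colour_def)
  ultimately show ?thesis by auto
qed

lemma finite_colour_class:
  assumes "n \<noteq> 0" "j < m + n"
  shows "finite (colour m n -` {j}) \<longleftrightarrow> j < m"
proof
  assume "j < m"
  then have "colour m n -` {j} \<subseteq> {..<m}"
    by (auto simp: colour_def split: if_splits)
  then show "finite (colour m n -` {j})"
    by (rule finite_subset) simp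
next
  assume fin: "finite (colour m n -` {j})"
  show "j < m"
  proof (rule ccontr)
    assume "\<not> j < m"
    \<comment> \<open>The class of a colour from \<open>m\<close> on contains an arithmetic
      progression with difference \<open>n\<close>, so it is infinite.\<close>
    then have "colour m n (j + n * i) = j" for i
    proof -
      have "j + n * i - m = (j - m) + n * i" "j - m < n"
        using \<open>\<not> j < m\<close> assms(2) by simp_all
      then have "(j + n * i - m) mod n = j - m"
        by (metis mod_less mod_mult_self2)
      then show ?thesis
        using \<open>\<not> j < m\<close> by (simp add: colour_def)
    qed
    then have "range (\<lambda>i. j + n * i) \<subseteq> colour m n -` {j}"
      by auto
    then have "finite (range (\<lambda>i. j + n * i))"
      using fin by (rule finite_subset)
    moreover have "inj (\<lambda>i. j + n * i)"
      using assms by (simp add: inj_on_def)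
    ultimately show False
      using finite_imageD infinite_UNIV_nat by blast
  qed
qed

theorem mainTheorem10:
  fixes n m :: nat
  assumes "CH" and "n \<noteq> 0"
  shows "\<exists>G. maximal_cofinitary_group G
     \<and> finite {X \<in> orbits G. infinite X} \<and> card {X \<in> orbits G. infinite X} = n
     \<and> finite {X \<in> orbits G. finite X} \<and> card {X \<in> orbits G. finite X} = m"
proof -
  let ?c = "colour m n" and ?G0 = "range (shift m n)"
  obtain G where G: "maximal_cofinitary_group G" "?G0 \<subseteq> G" "\<forall>f\<in>G. ?c \<circ> f = ?c"
    using maximal_cofinitary_extension[OF \<open>CH\<close>, of ?c ?G0] range_colour[OF \<open>n \<noteq> 0\<close>]
      cofinitary_group_shifts[OF \<open>n \<noteq> 0\<close>] colour_shift[OF \<open>n \<noteq> 0\<close>] by auto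
  let ?f = "\<lambda>j. ?c -` {j}"
  have "orbits G = ?f ` range ?c"
    using orbit_colour[OF \<open>n \<noteq> 0\<close> G(2,3)] by (auto simp: orbits_def)
  then have orb: "orbits G = ?f ` {..<m + n}"
    by (simp add: range_colour[OF \<open>n \<noteq> 0\<close>])
  \<comment> \<open>Every colour below \<open>m + n\<close> is attained, so distinct colours have
    distinct nonempty classes, and counting orbits amounts to counting colours.\<close>
  have inj: "inj_on ?f {..<m + n}"
  proof (rule inj_onI)
    fix i j assume "i \<in> {..<m + n}" "?f i = ?f j"
    moreover from this obtain k where "?c k = i"
      using range_colour[OF \<open>n \<noteq> 0\<close>, of m] by (metis imageE)
    ultimately show "i = j" by auto
  qed
  note fin = finite_colour_class[OF \<open>n \<noteq> 0\<close>]
  have "{X \<in> orbits G. infinite X} = ?f ` {m..<m + n}"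
    unfolding orb using fin by (auto simp: not_less)
  moreover have "{X \<in> orbits G. finite X} = ?f ` {..<m}"
    unfolding orb using fin by auto
  moreover have "card (?f ` {m..<m + n}) = n"
    by (subst card_image[OF inj_on_subset[OF inj]]) auto
  moreover have "card (?f ` {..<m}) = m"
    by (subst card_image[OF inj_on_subset[OF inj]]) auto
  ultimately show ?thesis
    using G(1) by (intro exI[of _ G]) simp
qed

end
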